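(* Let $\chi$ be a nonlinear kernel with data $(L,\psi,\alpha,\beta)$ relative to $\Pi=(t_k)_{k\in\mathbb{Z}}$, with $\psi$ concave, and let $f\in\mathcal{C}(\mathbb{R}^+)$. Fix $j\in\mathbb{N}$, $j\ge 1$, and let $M_1,M_2>0$ be constants such that $\mathcal{S}^j_w(x)\le M_1w^{-\alpha}$ and $\mathcal{T}^j_w(x)\le M_2w^{-\alpha}$ for all $x\in\mathbb{R}^+$ and all sufficiently large $w>0$. Then, for sufficiently large $w>0$: 1. if $\beta\ge1$, $$\|K^\chi_wf-f\|_\infty\le M_3\,\psi\Big(\widetilde\omega\Big(f,\frac1w\Big)\Big)+M_1w^{-\alpha}+M_2\|f\|_\infty w^{-\alpha};$$ 2. if $0<\beta<1$, $$\|K^\chi_wf-f\|_\infty\le M_4\,\psi\big(\widetilde\omega(f,w^{-\beta})\big)+2^{\beta+1}\,\psi(\|f\|_\infty)\,w^{-\beta}\,M_{\beta,\Pi}(L)+M_1w^{-\alpha}+M_2\|f\|_\infty w^{-\alpha},$$ where $M_3:=M_{0,\Pi}(L)+\Delta\,M_{0,\Pi}(L)+M_{1,\Pi}(L)$ and $M_4:=M_{0,\Pi}(L)+M_{\beta,\Pi}(L)+\Delta^\beta M_{0,\Pi}(L)$.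
   Context: Notation: $\mathbb{R}^+=(0,\infty)$, $\mathbb{R}^+_0=[0,\infty)$; $\mu$ is the logarithmic (Haar) measure $\mu(A)=\int_A \frac{dt}{t}$ on $\mathbb{R}^+$, and $L^1_\mu(\mathbb{R}^+)$ the corresponding Lebesgue space; $\|\cdot\|_\infty$ is the sup norm on $\mathbb{R}^+$. $\mathcal{C}(\mathbb{R}^+)$ is the space of bounded functions $f:\mathbb{R}^+\to\mathbb{R}$ that are log-uniformly continuous: for every $\varepsilon>0$ there is $\delta'>0$ such that $|f(u)-f(v)|<\varepsilon$ whenever $u,v\in\mathbb{R}^+$, $|\ln u-\ln v|\le\delta'$. The log-modulus of continuity is $\widetilde\omega(f,\delta'):=\sup\{|f(x)-f(y)|: x,y\in\mathbb{R}^+,\ |\ln x-\ln y|\le\delta'\}$, $\delta'>0$. $\Pi=(t_k)_{k\in\mathbb{Z}}$ is a sequence of real numbers with $t_k<t_{k+1}$, $\lim_{k\to\pm\infty}t_k=\pm\infty$, for which there are constants $\Delta,\delta>0$ with $\delta\le\Delta_k:=t_{k+1}-t_k\le\Delta$ for every $k\in\mathbb{Z}$. A nonlinear kernel with data $(L,\psi,\alpha,\beta)$, where $L:\mathbb{R}^+\to\mathbb{R}^+_0$ is measurable, $\psi:\mathbb{R}^+_0\to\mathbb{R}^+_0$ is non-decreasing and continuous with $\psi(0)=0$, and $\alpha,\beta>0$, is a function $\chi:\mathbb{R}^+\times\mathbb{R}\to\mathbb{R}$ such that: (1) $(\chi(e^{-t_k}x^w,u))_k\in\ell^1(\mathbb{Z})$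 for every $x\in\mathbb{R}^+$, $u\in\mathbb{R}$, $w>0$; (2) $\chi(x,0)=0$ for every $x\in\mathbb{R}^+$; (3) $|\chi(x,u)-\chi(x,v)|\le L(x)\,\psi(|u-v|)$ for every $x\in\mathbb{R}^+$, $u,v\in\mathbb{R}$; (4) for every $j\in\mathbb{N}$ ($j\ge1$), $$\mathcal{S}^j_w(x):=\sup_{0\le|u|<1/j}\Big|\sum_{k\in\mathbb{Z}}\chi(e^{-t_k}x^w,u)-u\Big|=\mathcal{O}(w^{-\alpha}),\qquad \mathcal{T}^j_w(x):=\sup_{|u|\ge1/j}\Big|\frac1u\sum_{k\in\mathbb{Z}}\chi(e^{-t_k}x^w,u)-1\Big|=\mathcal{O}(w^{-\alpha})$$ as $w\to+\infty$, uniformly with respect to $x\in\mathbb{R}^+$; (5) $L\in L^1_\mu(\mathbb{R}^+)$ and $L$ is bounded; (6) $M_{\beta,\Pi}(L)<+\infty$, where for $\gamma\ge0$, $M_{\gamma,\Pi}(L):=\sup_{x\in\mathbb{R}^+}\sum_{k\in\mathbb{Z}}L(e^{-t_k}x)\,|\ln x-t_k|^\gamma$ (with $M_{0,\Pi}(L):=\sup_{x}\sum_k L(e^{-t_k}x)$). For $w>0$ and a locally integrable $f:\mathbb{R}^+\to\mathbb{R}$ for which the series converges for every $x$, the nonlinear exponential Kantorovich sampling operator is $$(K^\chi_w f)(x):=\sum_{k\in\mathbb{Z}}\chi\Big(e^{-t_k}x^w,\ \frac{w}{\Delta_k}\int_{t_k/w}^{t_{k+1}/w}f(e^u)\,du\Big),\qquad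 x\in\mathbb{R}^+.$$ *)

theory Defs
  imports "HOL-Analysis.Analysis"
begin

text \<open>
  Functions on the positive half-line are total functions on \<^typ>\<open>real\<close>; only their values on
  \<^term>\<open>{0<..} :: real set\<close> are ever constrained or used. Suprema that may a priori be infinite
  are taken in \<^typ>\<open>ennreal\<close>.
\<close>

definition log_measure :: "real measure" where
  "log_measure = density (lebesgue_on {0<..}) (\<lambda>x. ennreal (1 / x))"

definition sup_norm :: "(real \<Rightarrow> real) \<Rightarrow> ennreal" where
  "sup_norm f = (SUP x\<in>{0<..}. ennreal \<bar>f x\<bar>)"

definition log_uniformly_continuous :: "(real \<Rightarrow> real) \<Rightarrow> bool" where
  "log_uniformly_continuous f \<longleftrightarrow>
     (\<forall>\<epsilon>>0. \<exists>\<eta>>0. \<forall>u>0. \<forall>v>0. \<bar>ln u - ln v\<bar> \<le> \<eta> \<longrightarrow> \<bar>f u - f v\<bar> < \<epsilon>)"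

definition log_C :: "(real \<Rightarrow> real) set" where
  "log_C = {f. bounded (f ` {0<..}) \<and> log_uniformly_continuous f}"

definition log_modulus :: "(real \<Rightarrow> real) \<Rightarrow> real \<Rightarrow> ennreal" where
  "log_modulus f \<eta> =
     (SUP (x, y)\<in>{(x, y). 0 < x \<and> 0 < y \<and> \<bar>ln x - ln y\<bar> \<le> \<eta>}. ennreal \<bar>f x - f y\<bar>)"

definition sampling_nodes :: "(int \<Rightarrow> real) \<Rightarrow> real \<Rightarrow> real \<Rightarrow> bool" where
  "sampling_nodes t \<delta> \<Delta> \<longleftrightarrow>
     (\<forall>k. t k < t (k + 1)) \<and> filterlim t at_top at_top \<and> filterlim t at_bot at_bot \<and>
     0 < \<delta> \<and> 0 < \<Delta> \<and> (\<forall>k. \<delta> \<le> t (k + 1) - t k \<and> t (k + 1) - t k \<le> \<Delta>)"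

text \<open>
  The case distinction is needed because \<^term>\<open>0 powr 0 = (0::real)\<close>, whereas the moment of
  order \<^term>\<open>0::real\<close> carries no weight at all, also at the nodes with \<^prop>\<open>ln x = t k\<close>.
\<close>

definition abs_moment :: "(int \<Rightarrow> real) \<Rightarrow> (real \<Rightarrow> real) \<Rightarrow> real \<Rightarrow> ennreal" where
  "abs_moment t L \<gamma> =
     (SUP x\<in>{0<..}. \<Sum>\<^sub>\<infinity>k.
        ennreal (L (exp (- t k) * x) * (if \<gamma> = 0 then 1 else \<bar>ln x - t k\<bar> powr \<gamma>)))"

definition S_dev ::
    "(int \<Rightarrow> real) \<Rightarrow> (real \<Rightarrow> real \<Rightarrow> real) \<Rightarrow> nat \<Rightarrow> real \<Rightarrow> real \<Rightarrow> ennreal" where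
  "S_dev t chi j w x =
     (SUP u\<in>{u. 0 \<le> \<bar>u\<bar> \<and> \<bar>u\<bar> < 1 / real j}.
        ennreal \<bar>(\<Sum>\<^sub>\<infinity>k. chi (exp (- t k) * x powr w) u) - u\<bar>)"

definition T_dev ::
    "(int \<Rightarrow> real) \<Rightarrow> (real \<Rightarrow> real \<Rightarrow> real) \<Rightarrow> nat \<Rightarrow> real \<Rightarrow> real \<Rightarrow> ennreal" where
  "T_dev t chi j w x =
     (SUP u\<in>{u. \<bar>u\<bar> \<ge> 1 / real j}.
        ennreal \<bar>1 / u * (\<Sum>\<^sub>\<infinity>k. chi (exp (- t k) * x powr w) u) - 1\<bar>)"

definition nonlinear_kernel ::
    "(int \<Rightarrow> real) \<Rightarrow> (real \<Rightarrow> real) \<Rightarrow> (real \<Rightarrow> real) \<Rightarrow> real \<Rightarrow> real \<Rightarrow>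
     (real \<Rightarrow> real \<Rightarrow> real) \<Rightarrow> bool" where
  "nonlinear_kernel t L \<psi> \<alpha> \<beta> chi \<longleftrightarrow>
     L \<in> borel_measurable (lebesgue_on {0<..}) \<and> (\<forall>x>0. 0 \<le> L x) \<and>
     (\<forall>u\<ge>0. 0 \<le> \<psi> u) \<and> mono_on {0..} \<psi> \<and> continuous_on {0..} \<psi> \<and> \<psi> 0 = 0 \<and>
     0 < \<alpha> \<and> 0 < \<beta> \<and>
     (\<forall>x>0. \<forall>u. \<forall>w>0. (\<lambda>k. \<bar>chi (exp (- t k) * x powr w) u\<bar>) summable_on UNIV) \<and>
     (\<forall>x>0. chi x 0 = 0) \<and>
     (\<forall>x>0. \<forall>u v. \<bar>chi x u - chi x v\<bar> \<le> L x * \<psi> \<bar>u - v\<bar>) \<and>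
     (\<forall>j\<ge>1.
        (\<exists>C>0. \<forall>\<^sub>F w in at_top. \<forall>x>0. S_dev t chi j w x \<le> ennreal (C * w powr - \<alpha>)) \<and>
        (\<exists>C>0. \<forall>\<^sub>F w in at_top. \<forall>x>0. T_dev t chi j w x \<le> ennreal (C * w powr - \<alpha>))) \<and>
     integrable log_measure L \<and> bounded (L ` {0<..}) \<and>
     abs_moment t L \<beta> < \<infinity>"

definition kantorovich_mean :: "(int \<Rightarrow> real) \<Rightarrow> real \<Rightarrow> (real \<Rightarrow> real) \<Rightarrow> int \<Rightarrow> real" where
  "kantorovich_mean t w f k =
     w / (t (k + 1) - t k) * (LINT u:{t k / w..t (k + 1) / w}|lebesgue. f (exp u))"

definition kantorovich_term ::
    "(int \<Rightarrow> real) \<Rightarrow> (real \<Rightarrow> real \<Rightarrow> real) \<Rightarrow> real \<Rightarrow> (real \<Rightarrow> real) \<Rightarrow> real \<Rightarrow> int \<Rightarrow> real" where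
  "kantorovich_term t chi w f x k = chi (exp (- t k) * x powr w) (kantorovich_mean t w f k)"

text \<open>Meaningful only where the series converges; \<^const>\<open>infsum\<close> is \<^term>\<open>0::real\<close> elsewhere.\<close>

definition kantorovich ::
    "(int \<Rightarrow> real) \<Rightarrow> (real \<Rightarrow> real \<Rightarrow> real) \<Rightarrow> real \<Rightarrow> (real \<Rightarrow> real) \<Rightarrow> real \<Rightarrow> real" where
  "kantorovich t chi w f x = (\<Sum>\<^sub>\<infinity>k. kantorovich_term t chi w f x k)"

end

theory Submission
  imports Defs
begin

text \<open>
  Compare \<open>K\<^sub>w f (x)\<close> with the same series in which every mean is replaced by \<open>f x\<close>. The
  difference is at most \<open>\<Sum>\<^sub>k L (exp (-t\<^sub>k) x\<^sup>w) \<psi> \<bar>m\<^sub>k - f x\<bar>\<close>, and the distance of the second series from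
  \<open>f x\<close> is controlled by \<open>S\<close> or \<open>T\<close>, according to the size of \<open>\<bar>f x\<bar>\<close>. Since \<open>f \<circ> exp\<close> varies by at
  most \<open>(1 + c) \<omega>(f, \<eta>)\<close> over a distance \<open>c \<eta>\<close> and a concave \<open>\<psi>\<close> with \<open>\<psi> 0 = 0\<close> satisfies
  \<open>\<psi> (c u) \<le> c \<psi> u\<close> for \<open>c \<ge> 1\<close>, each \<open>\<psi> \<bar>m\<^sub>k - f x\<bar>\<close> has a bound of the form
  \<open>a + b \<bar>w ln x - t\<^sub>k\<bar>\<^sup>\<gamma>\<close>, which sums to \<open>a M\<^sub>0 + b M\<^sub>\<gamma>\<close>. For \<open>\<beta> < 1\<close> the modulus is used only at
  the nodes with \<open>\<bar>w ln x - t\<^sub>k\<bar> \<le> w / 2\<close>, where all distances are at most \<open>1\<close> for large \<open>w\<close> and hence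
  at most their own power of order \<open>\<beta>\<close>; at the other nodes
  \<open>1 \<le> (2 \<bar>w ln x - t\<^sub>k\<bar> / w)\<^sup>\<beta>\<close>.
\<close>

section \<open>Infinite sums in \<open>ennreal\<close> and their real counterparts\<close>

text \<open>An infinite sum in \<open>ennreal\<close> is the supremum of its finite partial sums,
  and multiplication by a constant, even an infinite one, commutes with suprema.\<close>

lemma infsum_cmult_ennreal:
  fixes f :: "'a \<Rightarrow> ennreal"
  shows "(\<Sum>\<^sub>\<infinity>k\<in>A. c * f k) = c * (\<Sum>\<^sub>\<infinity>k\<in>A. f k)"
proof -
  have "(\<Sum>\<^sub>\<infinity>k\<in>A. c * f k) = (SUP F\<in>{F. finite F \<and> F \<subseteq> A}. c * sum f F)"
    by (simp add: nonneg_infsum_complete sum_distrib_left)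
  also have "\<dots> = c * (SUP F\<in>{F. finite F \<and> F \<subseteq> A}. sum f F)"
    by (rule SUP_mult_left_ennreal[symmetric])
  finally show ?thesis
    by (simp add: nonneg_infsum_complete)
qed

lemma ennreal_infsum:
  fixes g :: "'a \<Rightarrow> real"
  assumes "g summable_on A" and "\<And>k. k \<in> A \<Longrightarrow> 0 \<le> g k"
  shows "ennreal (infsum g A) = (\<Sum>\<^sub>\<infinity>k\<in>A. ennreal (g k))"
proof -
  have "ennreal (infsum g A) = (SUP F\<in>{F. finite F \<and> F \<subseteq> A}. ennreal (sum g F))"
    using assms by (rule infsum_nonneg_is_SUPREMUM_ennreal)
  also have "\<dots> = (SUP F\<in>{F. finite F \<and> F \<subseteq> A}. \<Sum>k\<in>F. ennreal (g k))"
    using assms(2) by (intro SUP_cong refl sum_ennreal[symmetric]) blast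
  finally show ?thesis
    by (simp add: nonneg_infsum_complete)
qed

text \<open>A finite \<open>ennreal\<close> value bounds all finite partial sums, which is enough
  for nonnegative terms. This carries finiteness of a moment over to real summability.\<close>

lemma summable_on_of_ennreal_infsum_finite:
  fixes g :: "'a \<Rightarrow> real"
  assumes fin: "(\<Sum>\<^sub>\<infinity>k\<in>A. ennreal (g k)) < \<infinity>" and nonneg: "\<And>k. k \<in> A \<Longrightarrow> 0 \<le> g k"
  shows "g summable_on A"
proof (rule nonneg_bdd_above_summable_on)
  let ?S = "\<Sum>\<^sub>\<infinity>k\<in>A. ennreal (g k)"
  show "bdd_above (sum g ` {F. F \<subseteq> A \<and> finite F})"
  proof (rule bdd_aboveI2)
    fix F assume "F \<in> {F. F \<subseteq> A \<and> finite F}"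
    then have F: "F \<subseteq> A" "finite F" by auto
    have "ennreal (sum g F) = (\<Sum>k\<in>F. ennreal (g k))"
      using F nonneg by (intro sum_ennreal[symmetric]) auto
    also have "\<dots> \<le> ?S"
      using F by (simp add: nonneg_infsum_complete SUP_upper)
    also have "?S = ennreal (enn2real ?S)"
      using fin by simp
    finally show "sum g F \<le> enn2real ?S"
      by (simp add: ennreal_le_iff)
  qed
qed (use nonneg in auto)

section \<open>Elementary inequalities for powers, concave functions and averages\<close>

text \<open>After division by \<open>a + b\<close> the two fractions lie between 0 and 1, where a
  number is at most its power of order \<open>p \<le> 1\<close>, and they add up to 1.\<close>

lemma powr_add_le:
  fixes a b p :: real
  assumes "0 \<le> a" "0 \<le> b" "0 < p" "p \<le> 1"
  shows "(a + b) powr p \<le> a powr p + b powr p"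
proof (cases "a + b = 0")
  case False
  then have s: "0 < a + b" using assms by simp
  have le: "c / (a + b) \<le> (c / (a + b)) powr p" if "0 \<le> c" "c \<le> a + b" for c
  proof (cases "c = 0")
    case False
    then show ?thesis
      using that s assms powr_mono'[of p 1 "c / (a + b)"] by simp
  qed (use assms in simp)
  have "1 = a / (a + b) + b / (a + b)"
    using s by (simp add: add_divide_distrib[symmetric])
  also have "\<dots> \<le> (a powr p + b powr p) / (a + b) powr p"
    using le[of a] le[of b] assms s by (simp add: powr_divide add_divide_distrib)
  finally show ?thesis
    using s by (simp add: field_simps)
qed (use assms in auto)

text \<open>The point \<open>u\<close> is the convex combination of 0 and \<open>c * u\<close> with
  weights \<open>1 - 1 / c\<close> and \<open>1 / c\<close>, and \<open>\<psi> 0 = 0\<close> removes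
  the first term.\<close>

lemma concave_on_scale_le:
  fixes \<psi> :: "real \<Rightarrow> real"
  assumes "concave_on {0..} \<psi>" "\<psi> 0 = 0" "1 \<le> c" "0 \<le> u"
  shows "\<psi> (c * u) \<le> c * \<psi> u"
proof -
  have "(1 - 1 / c) * \<psi> 0 + 1 / c * \<psi> (c * u) \<le> \<psi> ((1 - 1 / c) *\<^sub>R 0 + (1 / c) *\<^sub>R (c * u))"
    using assms by (intro concave_onD) auto
  then show ?thesis
    using assms by (simp add: field_simps)
qed

lemma average_deviation_le:
  fixes g :: "real \<Rightarrow> real"
  assumes "a < b" "continuous_on {a..b} g" "\<And>u. u \<in> {a..b} \<Longrightarrow> \<bar>g u - c\<bar> \<le> B"
  shows "\<bar>1 / (b - a) * (LINT u:{a..b}|lebesgue. g u) - c\<bar> \<le> B"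
proof -
  have "(LINT u:{a..b}|lebesgue. g u) = integral {a..b} g"
    using assms(2) by (intro set_lebesgue_integral_eq_integral(2) absolutely_integrable_continuous_real)
  moreover have "((\<lambda>u. g u - c) has_integral (integral {a..b} g - (b - a) * c)) {a..b}"
    using assms(1,2) has_integral_const_real[of c a b]
    by (intro has_integral_diff integrable_integral integrable_continuous_real) auto
  \<comment> \<open>The integral bound asks for \<open>0 \<le> B\<close>, which is read off at the
    endpoint \<open>a\<close>.\<close>
  then have "\<bar>integral {a..b} g - (b - a) * c\<bar> \<le> B * (b - a)"
    using has_integral_bound_real[of B "{}" "\<lambda>u. g u - c" _ a b] assms(1,3)
      order_trans[OF abs_ge_zero assms(3)[of a]] by simp
  then have "\<bar>integral {a..b} g - (b - a) * c\<bar> / (b - a) \<le> B"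
    using assms(1) by (simp add: field_simps)
  moreover have "1 / (b - a) * integral {a..b} g - c = (integral {a..b} g - (b - a) * c) / (b - a)"
    using assms(1) by (simp add: field_simps)
  ultimately show ?thesis
    using assms(1) by (simp add: abs_divide)
qed

section \<open>Log-uniformly continuous functions and their modulus\<close>

text \<open>The substitution by \<open>exp\<close> turns log-uniform continuity into ordinary
  uniform continuity; this makes the integrands of the Kantorovich means integrable.\<close>

lemma log_C_continuous_exp:
  assumes "f \<in> log_C"
  shows "continuous_on A (\<lambda>u. f (exp u))"
proof (rule uniformly_continuous_imp_continuous, unfold uniformly_continuous_on_def, intro allI impI)
  fix e :: real assume "0 < e"
  then obtain d where d: "0 < d" "\<And>u v. 0 < u \<Longrightarrow> 0 < v \<Longrightarrow> \<bar>ln u - ln v\<bar> \<le> d \<Longrightarrow> \<bar>f u - f v\<bar> < e"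
    using assms unfolding log_C_def log_uniformly_continuous_def by auto
  then show "\<exists>d>0. \<forall>x\<in>A. \<forall>x'\<in>A. dist x' x < d \<longrightarrow> dist (f (exp x')) (f (exp x)) < e"
    by (intro exI[of _ d]) (auto simp: dist_real_def)
qed

lemma log_C_bounded:
  assumes "f \<in> log_C"
  obtains B where "0 \<le> B" "sup_norm f = ennreal B" "\<And>x. 0 < x \<Longrightarrow> \<bar>f x\<bar> \<le> B"
proof -
  obtain C where C: "\<And>x. 0 < x \<Longrightarrow> \<bar>f x\<bar> \<le> C"
    using assms unfolding log_C_def bounded_iff by auto
  have "sup_norm f \<le> ennreal C"
    unfolding sup_norm_def using C by (intro SUP_least) (auto simp: ennreal_leI)
  then have fin: "sup_norm f = ennreal (enn2real (sup_norm f))"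
    by (metis ennreal_enn2real ennreal_less_top le_less_trans)
  have "\<bar>f x\<bar> \<le> enn2real (sup_norm f)" if "0 < x" for x
  proof -
    have "ennreal \<bar>f x\<bar> \<le> sup_norm f"
      unfolding sup_norm_def using that by (intro SUP_upper) auto
    then show ?thesis
      using fin by (metis enn2real_nonneg ennreal_le_iff)
  qed
  with fin that show ?thesis by (metis enn2real_nonneg)
qed

text \<open>Since \<open>enn2real\<close> sends infinity to 0, the modulus must first be shown
  finite; twice a bound of \<open>f\<close> majorises it.\<close>

lemma log_modulus_bound:
  assumes "f \<in> log_C" "0 < x" "0 < y" "\<bar>ln x - ln y\<bar> \<le> \<eta>"
  shows "\<bar>f x - f y\<bar> \<le> enn2real (log_modulus f \<eta>)"
proof -
  obtain B where B: "0 \<le> B" "\<And>x. 0 < x \<Longrightarrow> \<bar>f x\<bar> \<le> B"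
    using assms(1) by (rule log_C_bounded) blast
  have le: "\<bar>f u - f v\<bar> \<le> 2 * B" if "0 < u" "0 < v" for u v
    using B(2)[of u] B(2)[of v] that by linarith
  have "log_modulus f \<eta> \<le> ennreal (2 * B)"
    unfolding log_modulus_def
    by (rule SUP_least, clarify, rule ennreal_leI, rule le)
  then have fin: "log_modulus f \<eta> = ennreal (enn2real (log_modulus f \<eta>))"
    by (metis ennreal_enn2real ennreal_less_top le_less_trans)
  have "ennreal \<bar>f x - f y\<bar> \<le> log_modulus f \<eta>"
    unfolding log_modulus_def using assms(2-4) by (intro SUP_upper2[of "(x, y)"]) auto
  then show ?thesis
    using fin by (metis enn2real_nonneg ennreal_le_iff)
qed

text \<open>The segment from \<open>a\<close> to \<open>b\<close> is cut into \<open>n\<close> equal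
  steps of length at most \<open>\<eta>\<close>, each costing one modulus.\<close>

lemma log_modulus_multiple:
  assumes f: "f \<in> log_C"
  shows "\<bar>a - b\<bar> \<le> real n * \<eta> \<Longrightarrow> \<bar>f (exp a) - f (exp b)\<bar> \<le> real n * enn2real (log_modulus f \<eta>)"
proof (induction n arbitrary: b)
  case (Suc n)
  \<comment> \<open>The last intermediate point: \<open>n\<close> of the \<open>n + 1\<close> steps
    lead from \<open>a\<close> to \<open>c\<close>, the remaining one from \<open>c\<close> to
    \<open>b\<close>.\<close>
  define c where "c = a + (b - a) * (real n / real (Suc n))"
  have "\<bar>a - c\<bar> = \<bar>a - b\<bar> * (real n / real (Suc n))"
    unfolding c_def by (simp add: abs_mult abs_minus_commute)
  also have "\<dots> \<le> real (Suc n) * \<eta> * (real n / real (Suc n))"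
    using Suc.prems by (intro mult_right_mono) auto
  finally have ac: "\<bar>a - c\<bar> \<le> real n * \<eta>" by (simp add: mult.commute)
  have "c - b = (a - b) / real (Suc n)"
    unfolding c_def by (simp add: field_simps)
  then have "\<bar>c - b\<bar> = \<bar>a - b\<bar> / real (Suc n)"
    by (simp add: abs_divide)
  also have "\<dots> \<le> \<eta>"
    using Suc.prems by (simp add: pos_divide_le_eq mult.commute del: of_nat_Suc)
  finally have "\<bar>c - b\<bar> \<le> \<eta>" .
  then have "\<bar>f (exp c) - f (exp b)\<bar> \<le> enn2real (log_modulus f \<eta>)"
    using f by (intro log_modulus_bound) auto
  with Suc.IH[OF ac] show ?case
    by (simp add: algebra_simps)
qed simp

text \<open>Rounding \<open>c\<close> up to a whole number of steps adds at most 1, whence the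
  factor \<open>1 + c\<close>.\<close>

lemma log_modulus_scale:
  assumes f: "f \<in> log_C" and x: "0 < x" and "0 \<le> c" "0 < \<eta>" and d: "\<bar>a - ln x\<bar> \<le> c * \<eta>"
  shows "\<bar>f (exp a) - f x\<bar> \<le> (1 + c) * enn2real (log_modulus f \<eta>)"
proof -
  let ?n = "nat \<lceil>c\<rceil>"
  have n: "c \<le> real ?n" "real ?n \<le> 1 + c"
    using \<open>0 \<le> c\<close> by linarith+
  have "\<bar>a - ln x\<bar> \<le> real ?n * \<eta>"
    using d n(1) \<open>0 < \<eta>\<close> by (meson less_imp_le mult_right_mono order_trans)
  then have "\<bar>f (exp a) - f (exp (ln x))\<bar> \<le> real ?n * enn2real (log_modulus f \<eta>)"
    by (rule log_modulus_multiple[OF f])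
  also have "\<dots> \<le> (1 + c) * enn2real (log_modulus f \<eta>)"
    using n(2) by (intro mult_right_mono) auto
  finally show ?thesis using x by simp
qed

section \<open>Nodes, kernel conditions and moments\<close>

text \<open>Divergence of the nodes in both directions confines these indices to a bounded
  interval.\<close>

lemma sampling_nodes_finite_near:
  assumes "sampling_nodes t \<delta> \<Delta>"
  shows "finite {k. \<bar>y - t k\<bar> < r}"
proof -
  have "\<forall>\<^sub>F k in at_top. y + r \<le> t k" "\<forall>\<^sub>F k in at_bot. t k \<le> y - r"
    using assms unfolding sampling_nodes_def filterlim_at_top filterlim_at_bot by blast+
  then obtain a b where "\<And>k. k \<ge> b \<Longrightarrow> y + r \<le> t k" "\<And>k. k \<le> a \<Longrightarrow> t k \<le> y - r"
    unfolding eventually_at_top_linorder eventually_at_bot_linorder by blast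
  then have far: "r \<le> \<bar>y - t k\<bar>" if "b \<le> k \<or> k \<le> a" for k
    using that by (smt (verit))
  have "{k. \<bar>y - t k\<bar> < r} \<subseteq> {a..b}"
  proof
    fix k assume "k \<in> {k. \<bar>y - t k\<bar> < r}"
    then show "k \<in> {a..b}"
      using far[of k] by force
  qed
  then show ?thesis by (rule finite_subset) simp
qed


lemma nonlinear_kernelD:
  assumes "nonlinear_kernel t L \<psi> \<alpha> \<beta> chi"
  shows "\<And>x. 0 < x \<Longrightarrow> 0 \<le> L x" "\<And>u. 0 \<le> u \<Longrightarrow> 0 \<le> \<psi> u"
    "\<And>u v. 0 \<le> u \<Longrightarrow> u \<le> v \<Longrightarrow> \<psi> u \<le> \<psi> v" "\<psi> 0 = 0" "0 < \<beta>"
    "\<And>x u w. 0 < x \<Longrightarrow> 0 < w \<Longrightarrow> (\<lambda>k. \<bar>chi (exp (- t k) * x powr w) u\<bar>) summable_on UNIV"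
    "\<And>x. 0 < x \<Longrightarrow> chi x 0 = 0"
    "\<And>x u v. 0 < x \<Longrightarrow> \<bar>chi x u - chi x v\<bar> \<le> L x * \<psi> \<bar>u - v\<bar>"
    "abs_moment t L \<beta> < \<infinity>"
proof -
  fix u v :: real assume "0 \<le> u" "u \<le> v"
  moreover have "mono_on {0..} \<psi>"
    using assms unfolding nonlinear_kernel_def by blast
  ultimately show "\<psi> u \<le> \<psi> v"
    unfolding mono_on_def by simp
qed (use assms in \<open>auto simp: nonlinear_kernel_def\<close>)

lemma moment_sum_le:
  assumes "0 < y"
  shows "(\<Sum>\<^sub>\<infinity>k. ennreal (L (exp (- t k) * y) * (if \<gamma> = 0 then 1 else \<bar>ln y - t k\<bar> powr \<gamma>)))
    \<le> abs_moment t L \<gamma>"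
  unfolding abs_moment_def using assms by (intro SUP_upper) auto

text \<open>Both cases of the theorem majorise \<open>\<psi>\<close> of the deviation by a constant
  plus a multiple of a power of the distance to the node. The condition
  \<open>\<gamma> \<noteq> 0\<close> selects the weighted branch of
  \<open>abs_moment\<close>.\<close>

lemma weighted_moment_sum_le:
  assumes "0 < y" "\<gamma> \<noteq> 0" "0 \<le> a" "0 \<le> b" and L: "\<And>x. 0 < x \<Longrightarrow> 0 \<le> L x"
  shows "(\<Sum>\<^sub>\<infinity>k. ennreal (L (exp (- t k) * y) * (a + b * \<bar>ln y - t k\<bar> powr \<gamma>)))
    \<le> ennreal a * abs_moment t L 0 + ennreal b * abs_moment t L \<gamma>"
proof -
  let ?L = "\<lambda>k. L (exp (- t k) * y)"
  have nn: "0 \<le> ?L k" for k using assms(1) L by simp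
  have "(\<Sum>\<^sub>\<infinity>k. ennreal (?L k * (a + b * \<bar>ln y - t k\<bar> powr \<gamma>)))
      = (\<Sum>\<^sub>\<infinity>k. ennreal a * ennreal (?L k) + ennreal b * ennreal (?L k * \<bar>ln y - t k\<bar> powr \<gamma>))"
    using assms(3,4) nn
    by (intro infsum_cong) (simp add: ennreal_mult[symmetric] ennreal_plus[symmetric] algebra_simps del: ennreal_plus)
  also have "\<dots> = ennreal a * (\<Sum>\<^sub>\<infinity>k. ennreal (?L k))
      + ennreal b * (\<Sum>\<^sub>\<infinity>k. ennreal (?L k * \<bar>ln y - t k\<bar> powr \<gamma>))"
    by (simp add: infsum_add nonneg_summable_on_complete infsum_cmult_ennreal)
  also have "\<dots> \<le> ennreal a * abs_moment t L 0 + ennreal b * abs_moment t L \<gamma>"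
    using moment_sum_le[OF assms(1), of L t 0] moment_sum_le[OF assms(1), of L t \<gamma>] assms(2)
    by (intro add_mono mult_left_mono) auto
  finally show ?thesis .
qed

text \<open>At nodes with \<open>|ln y - t k| \<ge> 1\<close> the weight of the moment of order
  \<open>\<beta>\<close> is at least 1, so that finite moment dominates; only finitely many nodes
  remain.\<close>

lemma kernel_bound_summable:
  assumes nodes: "sampling_nodes t \<delta> \<Delta>" and ker: "nonlinear_kernel t L \<psi> \<alpha> \<beta> chi" and y: "0 < y"
  shows "(\<lambda>k. L (exp (- t k) * y)) summable_on UNIV"
proof -
  note K = nonlinear_kernelD[OF ker]
  let ?L = "\<lambda>k. L (exp (- t k) * y)" and ?F = "{k. \<bar>ln y - t k\<bar> < 1}"
  have nn: "0 \<le> ?L k" for k using y K(1) by simp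
  have "(\<lambda>k. ?L k * \<bar>ln y - t k\<bar> powr \<beta>) summable_on UNIV"
    using moment_sum_le[OF y, of L t \<beta>] K(5,9) nn
    by (intro summable_on_of_ennreal_infsum_finite) auto
  then have "(\<lambda>k. ?L k * \<bar>ln y - t k\<bar> powr \<beta>) summable_on (- ?F)"
    by (rule summable_on_subset_banach) simp
  then have "?L summable_on (- ?F)"
  proof (rule summable_on_comparison_test)
    fix k assume "k \<in> - ?F"
    then have "1 \<le> \<bar>ln y - t k\<bar> powr \<beta>"
      using K(5) by (intro ge_one_powr_ge_zero) auto
    then show "?L k \<le> ?L k * \<bar>ln y - t k\<bar> powr \<beta>"
      using nn[of k] mult_left_mono[of 1 _ "?L k"] by simp
  qed (rule nn)
  moreover have "?L summable_on ?F"
    using sampling_nodes_finite_near[OF nodes] by (rule summable_on_finite)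
  ultimately show ?thesis
    using summable_on_Un_disjoint[of ?L "?F" "- ?F"] by (simp add: Compl_partition)
qed

section \<open>Kantorovich means and convergence of the operator\<close>

text \<open>The prefactor is the reciprocal length of the integration interval, so the mean is a
  genuine average of \<open>f (exp u)\<close>.\<close>

lemma kantorovich_mean_deviation_le:
  assumes nodes: "sampling_nodes t \<delta> \<Delta>" and f: "f \<in> log_C" and w: "0 < w"
    and B: "\<And>u. t k / w \<le> u \<Longrightarrow> u \<le> t (k + 1) / w \<Longrightarrow> \<bar>f (exp u) - c\<bar> \<le> B"
  shows "\<bar>kantorovich_mean t w f k - c\<bar> \<le> B"
proof -
  have "t k < t (k + 1)"
    using nodes unfolding sampling_nodes_def by blast
  then have "t k / w < t (k + 1) / w" and "w / (t (k + 1) - t k) = 1 / (t (k + 1) / w - t k / w)"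
    using w by (auto simp: field_simps)
  then show ?thesis
    unfolding kantorovich_mean_def
    using average_deviation_le[OF _ log_C_continuous_exp[OF f], of "t k / w" "t (k + 1) / w" c B] B
    by simp
qed

text \<open>Comparing with \<open>chi\<close> at 0, where it vanishes, bounds each term by
  \<open>L\<close> times \<open>\<psi> B\<close>, with \<open>B\<close> a bound of \<open>f\<close>
  and hence of its means.\<close>

lemma kantorovich_term_summable:
  assumes nodes: "sampling_nodes t \<delta> \<Delta>" and ker: "nonlinear_kernel t L \<psi> \<alpha> \<beta> chi"
    and f: "f \<in> log_C" and "0 < x" "0 < w"
  shows "kantorovich_term t chi w f x summable_on UNIV"
proof -
  note K = nonlinear_kernelD[OF ker]
  obtain B where B: "0 \<le> B" "\<And>x. 0 < x \<Longrightarrow> \<bar>f x\<bar> \<le> B"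
    using f by (rule log_C_bounded) blast
  have pos: "0 < exp (- t k) * x powr w" for k using assms by simp
  have "(\<lambda>k. L (exp (- t k) * x powr w) * \<psi> B) summable_on UNIV"
    using kernel_bound_summable[OF nodes ker, of "x powr w"] \<open>0 < x\<close>
    by (intro summable_on_cmult_left) auto
  then have "(\<lambda>k. norm (kantorovich_term t chi w f x k)) summable_on UNIV"
  proof (rule summable_on_comparison_test)
    fix k
    have "\<bar>kantorovich_mean t w f k - 0\<bar> \<le> B"
      using B by (intro kantorovich_mean_deviation_le[OF nodes f \<open>0 < w\<close>]) auto
    then have "L (exp (- t k) * x powr w) * \<psi> \<bar>kantorovich_mean t w f k\<bar>
        \<le> L (exp (- t k) * x powr w) * \<psi> B"
      using K(1)[OF pos] K(3) by (intro mult_left_mono) auto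
    moreover have "\<bar>kantorovich_term t chi w f x k\<bar>
        \<le> L (exp (- t k) * x powr w) * \<psi> \<bar>kantorovich_mean t w f k\<bar>"
      unfolding kantorovich_term_def
      using K(8)[OF pos, of k "kantorovich_mean t w f k" 0] K(7)[OF pos] by simp
    ultimately show "norm (kantorovich_term t chi w f x k) \<le> L (exp (- t k) * x powr w) * \<psi> B"
      by simp
  qed simp
  then show ?thesis by (rule abs_summable_summable)
qed

section \<open>Decomposition of the approximation error\<close>

text \<open>The series with all means replaced by \<open>f x\<close> is subtracted and added. The
  majorant \<open>P\<close> is left abstract so that both ranges of \<open>\<beta>\<close> can
  supply their own.\<close>

lemma kantorovich_error_split:
  assumes nodes: "sampling_nodes t \<delta> \<Delta>" and ker: "nonlinear_kernel t L \<psi> \<alpha> \<beta> chi"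
    and f: "f \<in> log_C" and x: "0 < x" and w: "0 < w"
    and P: "\<And>k. \<psi> \<bar>kantorovich_mean t w f k - f x\<bar> \<le> P k"
  shows "ennreal \<bar>kantorovich t chi w f x - f x\<bar>
    \<le> (\<Sum>\<^sub>\<infinity>k. ennreal (L (exp (- t k) * x powr w) * P k))
      + ennreal \<bar>(\<Sum>\<^sub>\<infinity>k. chi (exp (- t k) * x powr w) (f x)) - f x\<bar>"
proof -
  note K = nonlinear_kernelD[OF ker]
  let ?z = "\<lambda>k. exp (- t k) * x powr w"
  let ?m = "kantorovich_mean t w f"
  let ?d = "\<lambda>k. chi (?z k) (?m k) - chi (?z k) (f x)"
  have pos: "0 < ?z k" for k using x by simp
  obtain B where B: "0 \<le> B" "\<And>x. 0 < x \<Longrightarrow> \<bar>f x\<bar> \<le> B"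
    using f by (rule log_C_bounded) blast
  \<comment> \<open>The crude bound \<open>2 * B\<close> on the deviations serves only to make the
    series of differences converge; the estimate itself comes from \<open>P\<close>.\<close>
  have sumL: "(\<lambda>k. L (?z k) * \<psi> (2 * B)) summable_on UNIV"
    using kernel_bound_summable[OF nodes ker, of "x powr w"] x
    by (intro summable_on_cmult_left) auto
  have "\<bar>?m k - f x\<bar> \<le> 2 * B" for k
  proof (rule kantorovich_mean_deviation_le[OF nodes f w])
    show "\<bar>f (exp u) - f x\<bar> \<le> 2 * B" for u
      using B(2)[of "exp u"] B(2)[OF x] by simp
  qed
  then have "\<bar>?d k\<bar> \<le> L (?z k) * \<psi> (2 * B)" for k
    by (rule order_trans[OF K(8)[OF pos] mult_left_mono[OF K(3)[OF abs_ge_zero] K(1)[OF pos]]])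
  then have abs_d: "(\<lambda>k. \<bar>?d k\<bar>) summable_on UNIV"
    by (rule summable_on_comparison_test[OF sumL]) simp
  have const: "(\<lambda>k. chi (?z k) (f x)) summable_on UNIV"
    by (rule abs_summable_summable) (use K(6)[OF x w] in simp)
  have "kantorovich t chi w f x = (\<Sum>\<^sub>\<infinity>k. ?d k + chi (?z k) (f x))"
    unfolding kantorovich_def kantorovich_term_def by simp
  also have "\<dots> = infsum ?d UNIV + (\<Sum>\<^sub>\<infinity>k. chi (?z k) (f x))"
    by (rule infsum_add[OF abs_summable_summable const]) (use abs_d in simp)
  finally have "kantorovich t chi w f x = infsum ?d UNIV + (\<Sum>\<^sub>\<infinity>k. chi (?z k) (f x))" .
  moreover have "\<bar>infsum ?d UNIV\<bar> \<le> (\<Sum>\<^sub>\<infinity>k. \<bar>?d k\<bar>)"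
    using norm_infsum_bound[of ?d UNIV] abs_d by (simp only: real_norm_def)
  ultimately have "\<bar>kantorovich t chi w f x - f x\<bar>
      \<le> (\<Sum>\<^sub>\<infinity>k. \<bar>?d k\<bar>) + \<bar>(\<Sum>\<^sub>\<infinity>k. chi (?z k) (f x)) - f x\<bar>"
    by linarith
  then have "ennreal \<bar>kantorovich t chi w f x - f x\<bar>
      \<le> ennreal ((\<Sum>\<^sub>\<infinity>k. \<bar>?d k\<bar>) + \<bar>(\<Sum>\<^sub>\<infinity>k. chi (?z k) (f x)) - f x\<bar>)"
    by (rule ennreal_leI)
  also have "\<dots> = ennreal (\<Sum>\<^sub>\<infinity>k. \<bar>?d k\<bar>) + ennreal \<bar>(\<Sum>\<^sub>\<infinity>k. chi (?z k) (f x)) - f x\<bar>"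
    by (intro ennreal_plus infsum_nonneg abs_ge_zero)
  finally have split: "ennreal \<bar>kantorovich t chi w f x - f x\<bar>
      \<le> ennreal (\<Sum>\<^sub>\<infinity>k. \<bar>?d k\<bar>) + ennreal \<bar>(\<Sum>\<^sub>\<infinity>k. chi (?z k) (f x)) - f x\<bar>" .
  have "ennreal (\<Sum>\<^sub>\<infinity>k. \<bar>?d k\<bar>) = (\<Sum>\<^sub>\<infinity>k. ennreal \<bar>?d k\<bar>)"
    using abs_d by (rule ennreal_infsum) simp
  also have "\<dots> \<le> (\<Sum>\<^sub>\<infinity>k. ennreal (L (?z k) * P k))"
    by (intro infsum_mono ennreal_leI order_trans[OF K(8)[OF pos] mult_left_mono[OF P K(1)[OF pos]]])
      (simp_all add: nonneg_summable_on_complete)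
  finally show ?thesis
    by (intro order_trans[OF split] add_right_mono)
qed

text \<open>Below the threshold \<open>1 / j\<close> the bound is that of \<open>S_dev\<close>.
  Above it \<open>f x\<close> is nonzero, and factoring it out leaves the expression in
  \<open>T_dev\<close>, at the cost of a factor \<open>sup_norm f\<close>. The other summand is
  added for free.\<close>

lemma constant_error_le:
  assumes f: "f \<in> log_C" and "1 \<le> j" "0 < M1" "0 < M2" and x: "0 < x"
    and S: "S_dev t chi j w x \<le> ennreal (M1 * w powr - \<alpha>)"
    and T: "T_dev t chi j w x \<le> ennreal (M2 * w powr - \<alpha>)"
  shows "ennreal \<bar>(\<Sum>\<^sub>\<infinity>k. chi (exp (- t k) * x powr w) (f x)) - f x\<bar>
    \<le> ennreal (M1 * w powr - \<alpha>) + ennreal M2 * sup_norm f * ennreal (w powr - \<alpha>)"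
proof (cases "\<bar>f x\<bar> < 1 / real j")
  let ?s = "\<Sum>\<^sub>\<infinity>k. chi (exp (- t k) * x powr w) (f x)"
  case True
  then have "ennreal \<bar>?s - f x\<bar> \<le> S_dev t chi j w x"
    unfolding S_dev_def by (intro SUP_upper) auto
  then show ?thesis
    using S by (meson add_increasing2 order_trans zero_le)
next
  let ?s = "\<Sum>\<^sub>\<infinity>k. chi (exp (- t k) * x powr w) (f x)"
  case False
  then have "0 < \<bar>f x\<bar>"
    using \<open>1 \<le> j\<close> by (smt (verit) divide_pos_pos of_nat_0_less_iff less_le_trans zero_less_one)
  then have "\<bar>?s - f x\<bar> = \<bar>f x\<bar> * \<bar>1 / f x * ?s - 1\<bar>"
    by (simp add: abs_mult[symmetric] algebra_simps)
  then have "ennreal \<bar>?s - f x\<bar> = ennreal \<bar>f x\<bar> * ennreal \<bar>1 / f x * ?s - 1\<bar>"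
    by (simp add: ennreal_mult)
  also have "\<dots> \<le> sup_norm f * T_dev t chi j w x"
    unfolding T_dev_def sup_norm_def using x False by (intro mult_mono SUP_upper) auto
  also have "\<dots> \<le> sup_norm f * ennreal (M2 * w powr - \<alpha>)"
    using T by (rule mult_left_mono) simp
  also have "\<dots> = ennreal M2 * sup_norm f * ennreal (w powr - \<alpha>)"
    using \<open>0 < M2\<close> by (simp add: ennreal_mult ac_simps)
  finally show ?thesis
    by (meson add_increasing order_trans zero_le)
qed

text \<open>Common core of both cases, used with \<open>\<gamma>\<close> equal to 1 and to
  \<open>\<beta>\<close>. The moments are taken at \<open>x powr w\<close>, whose logarithm is
  \<open>w * ln x\<close>.\<close>

lemma kantorovich_error_le:
  assumes nodes: "sampling_nodes t \<delta> \<Delta>" and ker: "nonlinear_kernel t L \<psi> \<alpha> \<beta> chi"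
    and f: "f \<in> log_C" and "0 < w" "\<gamma> \<noteq> 0" "0 \<le> a" "0 \<le> b" and "1 \<le> j" "0 < M1" "0 < M2"
    and S: "\<forall>x>0. S_dev t chi j w x \<le> ennreal (M1 * w powr - \<alpha>)"
    and T: "\<forall>x>0. T_dev t chi j w x \<le> ennreal (M2 * w powr - \<alpha>)"
    and P: "\<And>x k. 0 < x \<Longrightarrow>
      \<psi> \<bar>kantorovich_mean t w f k - f x\<bar> \<le> a + b * \<bar>w * ln x - t k\<bar> powr \<gamma>"
  shows "sup_norm (\<lambda>x. kantorovich t chi w f x - f x)
    \<le> ennreal a * abs_moment t L 0 + ennreal b * abs_moment t L \<gamma>
      + ennreal (M1 * w powr - \<alpha>) + ennreal M2 * sup_norm f * ennreal (w powr - \<alpha>)"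
  unfolding sup_norm_def[of "\<lambda>x. kantorovich t chi w f x - f x"]
proof (rule SUP_least)
  fix x :: real assume "x \<in> {0<..}"
  then have x: "0 < x" by simp
  have "ennreal \<bar>kantorovich t chi w f x - f x\<bar>
    \<le> (\<Sum>\<^sub>\<infinity>k. ennreal (L (exp (- t k) * x powr w) * (a + b * \<bar>ln (x powr w) - t k\<bar> powr \<gamma>)))
      + ennreal \<bar>(\<Sum>\<^sub>\<infinity>k. chi (exp (- t k) * x powr w) (f x)) - f x\<bar>"
    using P[OF x] x by (intro kantorovich_error_split[OF nodes ker f x \<open>0 < w\<close>]) (simp add: ln_powr)
  also have "\<dots> \<le> (ennreal a * abs_moment t L 0 + ennreal b * abs_moment t L \<gamma>)
      + (ennreal (M1 * w powr - \<alpha>) + ennreal M2 * sup_norm f * ennreal (w powr - \<alpha>))"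
    using assms x nonlinear_kernelD(1)[OF ker]
    by (intro add_mono weighted_moment_sum_le constant_error_le) auto
  finally show "ennreal \<bar>kantorovich t chi w f x - f x\<bar>
    \<le> ennreal a * abs_moment t L 0 + ennreal b * abs_moment t L \<gamma>
      + ennreal (M1 * w powr - \<alpha>) + ennreal M2 * sup_norm f * ennreal (w powr - \<alpha>)"
    by (simp add: add.assoc)
qed

section \<open>Bounds for single nodes\<close>

lemma psi_log_modulus_scale_le:
  assumes nodes: "sampling_nodes t \<delta> \<Delta>" and ker: "nonlinear_kernel t L \<psi> \<alpha> \<beta> chi"
    and conc: "concave_on {0..} \<psi>" and f: "f \<in> log_C" and "0 < x" "0 < w" "0 \<le> c" "0 < \<eta>"
    and c: "\<And>u. t k / w \<le> u \<Longrightarrow> u \<le> t (k + 1) / w \<Longrightarrow> \<bar>u - ln x\<bar> \<le> c * \<eta>"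
  shows "\<psi> \<bar>kantorovich_mean t w f k - f x\<bar> \<le> (1 + c) * \<psi> (enn2real (log_modulus f \<eta>))"
proof -
  note K = nonlinear_kernelD[OF ker]
  have "\<bar>kantorovich_mean t w f k - f x\<bar> \<le> (1 + c) * enn2real (log_modulus f \<eta>)"
    using assms by (intro kantorovich_mean_deviation_le[OF nodes f] log_modulus_scale) auto
  then have "\<psi> \<bar>kantorovich_mean t w f k - f x\<bar> \<le> \<psi> ((1 + c) * enn2real (log_modulus f \<eta>))"
    by (intro K(3)) auto
  also have "\<dots> \<le> (1 + c) * \<psi> (enn2real (log_modulus f \<eta>))"
    using conc K(4) \<open>0 \<le> c\<close> by (intro concave_on_scale_le) auto
  finally show ?thesis .
qed

text \<open>The point \<open>w * u\<close> lies between \<open>t k\<close> and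
  \<open>t (k + 1)\<close>, hence within \<open>\<Delta>\<close> of \<open>t k\<close>; the triangle
  inequality does the rest.\<close>

lemma scaled_node_distance_le:
  assumes nodes: "sampling_nodes t \<delta> \<Delta>" and "0 < w" "t k / w \<le> u" "u \<le> t (k + 1) / w"
  shows "w * \<bar>u - v\<bar> \<le> \<bar>w * v - t k\<bar> + \<Delta>"
proof -
  have "t (k + 1) - t k \<le> \<Delta>"
    using nodes unfolding sampling_nodes_def by blast
  moreover have "t k \<le> w * u" "w * u \<le> t (k + 1)"
    using assms by (auto simp: field_simps)
  moreover have "w * \<bar>u - v\<bar> = \<bar>w * u - w * v\<bar>"
    using \<open>0 < w\<close> by (simp add: abs_mult right_diff_distrib[symmetric])
  ultimately show ?thesis by linarith
qed

section \<open>The quantitative estimates\<close>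

theorem theorem7:
  fixes t :: "int \<Rightarrow> real" and \<delta> \<Delta> \<alpha> \<beta> M1 M2 :: real
    and L \<psi> f :: "real \<Rightarrow> real" and chi :: "real \<Rightarrow> real \<Rightarrow> real" and j :: nat
  assumes "sampling_nodes t \<delta> \<Delta>"
    and "nonlinear_kernel t L \<psi> \<alpha> \<beta> chi"
    and "concave_on {0..} \<psi>"
    and "f \<in> log_C"
    and "1 \<le> j" and "0 < M1" and "0 < M2"
    and "\<forall>\<^sub>F w in at_top. \<forall>x>0. S_dev t chi j w x \<le> ennreal (M1 * w powr - \<alpha>)"
    and "\<forall>\<^sub>F w in at_top. \<forall>x>0. T_dev t chi j w x \<le> ennreal (M2 * w powr - \<alpha>)"
  defines "M3 \<equiv> abs_moment t L 0 + ennreal \<Delta> * abs_moment t L 0 + abs_moment t L 1"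
    and "M4 \<equiv> abs_moment t L 0 + abs_moment t L \<beta> + ennreal (\<Delta> powr \<beta>) * abs_moment t L 0"
  shows "(\<forall>w>0. \<forall>x>0. kantorovich_term t chi w f x summable_on UNIV) \<and>
    (1 \<le> \<beta> \<longrightarrow>
       (\<forall>\<^sub>F w in at_top.
          sup_norm (\<lambda>x. kantorovich t chi w f x - f x)
            \<le> M3 * ennreal (\<psi> (enn2real (log_modulus f (1 / w))))
              + ennreal (M1 * w powr - \<alpha>)
              + ennreal M2 * sup_norm f * ennreal (w powr - \<alpha>))) \<and>
    (0 < \<beta> \<and> \<beta> < 1 \<longrightarrow>
       (\<forall>\<^sub>F w in at_top.
          sup_norm (\<lambda>x. kantorovich t chi w f x - f x)
            \<le> M4 * ennreal (\<psi> (enn2real (log_modulus f (w powr - \<beta>))))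
              + ennreal (2 powr (\<beta> + 1)) * ennreal (\<psi> (enn2real (sup_norm f)))
                * ennreal (w powr - \<beta>) * abs_moment t L \<beta>
              + ennreal (M1 * w powr - \<alpha>)
              + ennreal M2 * sup_norm f * ennreal (w powr - \<alpha>)))"
proof (intro conjI impI allI)
  note nodes = assms(1) and ker = assms(2) and conc = assms(3) and f = assms(4)
  note K = nonlinear_kernelD[OF ker]
  have \<Delta>: "0 < \<Delta>" using nodes unfolding sampling_nodes_def by blast
  note S = assms(8) and T = assms(9)
  show "kantorovich_term t chi w f x summable_on UNIV" if "0 < w" "0 < x" for w x
    using kantorovich_term_summable[OF nodes ker f] that by blast
  show "\<forall>\<^sub>F w in at_top. sup_norm (\<lambda>x. kantorovich t chi w f x - f x)
      \<le> M3 * ennreal (\<psi> (enn2real (log_modulus f (1 / w)))) + ennreal (M1 * w powr - \<alpha>)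
        + ennreal M2 * sup_norm f * ennreal (w powr - \<alpha>)"
    using S T eventually_gt_at_top[of 0]
  proof eventually_elim
    case (elim w)
    let ?p = "\<psi> (enn2real (log_modulus f (1 / w)))"
    have p: "0 \<le> ?p" by (rule K(2)) simp
    \<comment> \<open>With \<open>\<eta> = 1 / w\<close> the scaling factor is
      \<open>1 + \<Delta>\<close> plus the distance to the node: the constant part meets the moment
      of order 0, the linear part that of order 1.\<close>
    have "\<psi> \<bar>kantorovich_mean t w f k - f x\<bar> \<le> (1 + \<Delta>) * ?p + ?p * \<bar>w * ln x - t k\<bar> powr 1"
      if "0 < x" for x k
    proof -
      have "\<psi> \<bar>kantorovich_mean t w f k - f x\<bar> \<le> (1 + (\<bar>w * ln x - t k\<bar> + \<Delta>)) * ?p"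
      proof (rule psi_log_modulus_scale_le[OF nodes ker conc f that])
        fix u assume "t k / w \<le> u" "u \<le> t (k + 1) / w"
        then show "\<bar>u - ln x\<bar> \<le> (\<bar>w * ln x - t k\<bar> + \<Delta>) * (1 / w)"
          using scaled_node_distance_le[OF nodes, of w k u "ln x"] elim by (simp add: field_simps)
      qed (use elim \<Delta> in auto)
      then show ?thesis by (simp add: algebra_simps)
    qed
    then have "sup_norm (\<lambda>x. kantorovich t chi w f x - f x)
      \<le> ennreal ((1 + \<Delta>) * ?p) * abs_moment t L 0 + ennreal ?p * abs_moment t L 1
        + ennreal (M1 * w powr - \<alpha>) + ennreal M2 * sup_norm f * ennreal (w powr - \<alpha>)"
      using elim assms(5-7) p \<Delta>
      by (intro kantorovich_error_le[OF nodes ker f]) auto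
    also have "ennreal ((1 + \<Delta>) * ?p) * abs_moment t L 0 + ennreal ?p * abs_moment t L 1 = M3 * ennreal ?p"
    proof -
      have "ennreal ((1 + \<Delta>) * ?p) = (1 + ennreal \<Delta>) * ennreal ?p"
        using p \<Delta> by (simp add: ennreal_mult)
      then show ?thesis
        unfolding M3_def by (simp only: distrib_left distrib_right mult_1_left ac_simps)
    qed
    finally show ?case .
  qed
  show "\<forall>\<^sub>F w in at_top. sup_norm (\<lambda>x. kantorovich t chi w f x - f x)
      \<le> M4 * ennreal (\<psi> (enn2real (log_modulus f (w powr - \<beta>))))
        + ennreal (2 powr (\<beta> + 1)) * ennreal (\<psi> (enn2real (sup_norm f)))
          * ennreal (w powr - \<beta>) * abs_moment t L \<beta>
        + ennreal (M1 * w powr - \<alpha>) + ennreal M2 * sup_norm f * ennreal (w powr - \<alpha>)"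
    if \<beta>: "0 < \<beta> \<and> \<beta> < 1"
    \<comment> \<open>The threshold \<open>2 * \<Delta>\<close> gives
      \<open>\<Delta> \<le> w / 2\<close>, so that at near nodes the distance plus
      \<open>\<Delta>\<close> is at most \<open>w\<close>.\<close>
    using S T eventually_gt_at_top[of 0] eventually_ge_at_top[of "2 * \<Delta>"]
  proof eventually_elim
    case (elim w)
    let ?p = "\<psi> (enn2real (log_modulus f (w powr - \<beta>)))"
    obtain B where B: "0 \<le> B" "sup_norm f = ennreal B" "\<And>x. 0 < x \<Longrightarrow> \<bar>f x\<bar> \<le> B"
      using f by (rule log_C_bounded) blast
    \<comment> \<open>One factor 2 comes from \<open>\<psi> (2 * B) \<le> 2 * \<psi> B\<close>, and
      \<open>2 powr \<beta>\<close> from the cutoff at \<open>w / 2\<close>.\<close>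
    let ?q = "2 powr (\<beta> + 1) * \<psi> B * w powr - \<beta>"
    have p: "0 \<le> ?p" by (rule K(2)) simp
    have q: "0 \<le> ?q" using K(2) B(1) by simp
    \<comment> \<open>A single majorant for all nodes: near nodes use the terms with
      \<open>?p\<close>, far nodes the term with \<open>?q\<close>.\<close>
    have "\<psi> \<bar>kantorovich_mean t w f k - f x\<bar>
        \<le> (1 + \<Delta> powr \<beta>) * ?p + (?p + ?q) * \<bar>w * ln x - t k\<bar> powr \<beta>"
      if x: "0 < x" for x k
    proof (cases "\<bar>w * ln x - t k\<bar> \<le> w / 2")
      let ?s = "\<bar>w * ln x - t k\<bar>"
      case True
      have "\<psi> \<bar>kantorovich_mean t w f k - f x\<bar> \<le> (1 + (?s powr \<beta> + \<Delta> powr \<beta>)) * ?p"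
      proof (rule psi_log_modulus_scale_le[OF nodes ker conc f x])
        fix u assume u: "t k / w \<le> u" "u \<le> t (k + 1) / w"
        have le: "w * \<bar>u - ln x\<bar> \<le> ?s + \<Delta>"
          using scaled_node_distance_le[OF nodes] u elim by blast
        also have "\<dots> \<le> w * 1" using True elim by simp
        finally have "\<bar>u - ln x\<bar> \<le> 1" using elim by simp
        then have "\<bar>u - ln x\<bar> \<le> \<bar>u - ln x\<bar> powr \<beta>"
          using powr_mono'[of \<beta> 1 "\<bar>u - ln x\<bar>"] \<beta> by simp
        \<comment> \<open>Pulling \<open>w\<close> into the power leaves
          \<open>w powr - \<beta>\<close>, exactly the step size \<open>\<eta>\<close> of the
          modulus in this case.\<close>
        also have "\<dots> = (w * \<bar>u - ln x\<bar>) powr \<beta> * w powr - \<beta>"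
          using elim by (simp add: powr_mult powr_minus)
        also have "\<dots> \<le> (?s + \<Delta>) powr \<beta> * w powr - \<beta>"
          using le \<beta> elim by (intro mult_right_mono powr_mono2) auto
        also have "\<dots> \<le> (?s powr \<beta> + \<Delta> powr \<beta>) * w powr - \<beta>"
          using \<beta> \<Delta> by (intro mult_right_mono powr_add_le) auto
        finally show "\<bar>u - ln x\<bar> \<le> (?s powr \<beta> + \<Delta> powr \<beta>) * w powr - \<beta>" .
      qed (use elim in auto)
      also have "\<dots> \<le> (1 + \<Delta> powr \<beta>) * ?p + (?p + ?q) * ?s powr \<beta>"
        using mult_nonneg_nonneg[OF q powr_ge_zero[of ?s \<beta>]] by (simp add: algebra_simps)
      finally show ?thesis .
    next
      let ?s = "\<bar>w * ln x - t k\<bar>"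
      case False
      have "\<bar>kantorovich_mean t w f k - f x\<bar> \<le> 2 * B"
      proof (rule kantorovich_mean_deviation_le[OF nodes f])
        show "\<bar>f (exp u) - f x\<bar> \<le> 2 * B" for u
          using B(3)[of "exp u"] B(3)[OF x] by simp
      qed (use elim in auto)
      then have "\<psi> \<bar>kantorovich_mean t w f k - f x\<bar> \<le> \<psi> (2 * B)"
        by (intro K(3)) auto
      \<comment> \<open>The factor 1 is kept in order to be replaced by a power of order
        \<open>\<beta>\<close> that is at least 1 at far nodes.\<close>
      also have "\<dots> \<le> 2 * \<psi> B * 1"
        using concave_on_scale_le[OF conc K(4), of 2 B] B(1) by simp
      also have "1 \<le> (?s * (2 / w)) powr \<beta>"
        using False elim \<beta> by (intro ge_one_powr_ge_zero) (auto simp: field_simps)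
      then have "2 * \<psi> B * 1 \<le> 2 * \<psi> B * (?s * (2 / w)) powr \<beta>"
        using K(2)[OF B(1)] by (intro mult_left_mono) auto
      also have "\<dots> = ?q * ?s powr \<beta>"
      proof -
        have "(?s * (2 / w)) powr \<beta> = ?s powr \<beta> * (2 powr \<beta> * w powr - \<beta>)"
          using elim by (simp add: powr_mult powr_divide powr_minus_divide)
        then show ?thesis by (simp add: powr_add)
      qed
      also have "\<dots> \<le> (1 + \<Delta> powr \<beta>) * ?p + (?p + ?q) * ?s powr \<beta>"
        using p mult_nonneg_nonneg[OF p powr_ge_zero[of ?s \<beta>]]
          mult_nonneg_nonneg[OF powr_ge_zero[of \<Delta> \<beta>] p]
        by (simp add: algebra_simps)
      finally show ?thesis by simp
    qed
    then have "sup_norm (\<lambda>x. kantorovich t chi w f x - f x)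
      \<le> ennreal ((1 + \<Delta> powr \<beta>) * ?p) * abs_moment t L 0 + ennreal (?p + ?q) * abs_moment t L \<beta>
        + ennreal (M1 * w powr - \<alpha>) + ennreal M2 * sup_norm f * ennreal (w powr - \<alpha>)"
      using elim assms(5-7) p q \<beta>
      by (intro kantorovich_error_le[OF nodes ker f]) auto
    also have "ennreal ((1 + \<Delta> powr \<beta>) * ?p) * abs_moment t L 0 + ennreal (?p + ?q) * abs_moment t L \<beta>
      = M4 * ennreal ?p + ennreal (2 powr (\<beta> + 1)) * ennreal (\<psi> (enn2real (sup_norm f)))
          * ennreal (w powr - \<beta>) * abs_moment t L \<beta>"
    proof -
      have "ennreal ((1 + \<Delta> powr \<beta>) * ?p) = (1 + ennreal (\<Delta> powr \<beta>)) * ennreal ?p"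
        using p by (simp add: ennreal_mult)
      moreover have "ennreal (?p + ?q)
          = ennreal ?p + ennreal (2 powr (\<beta> + 1)) * ennreal (\<psi> B) * ennreal (w powr - \<beta>)"
        using p q K(2)[OF B(1)] by (simp add: ennreal_mult)
      moreover have "enn2real (sup_norm f) = B"
        using B by simp
      ultimately show ?thesis
        unfolding M4_def by (simp only: distrib_left distrib_right mult_1_left ac_simps)
    qed
    finally show ?case .
  qed
qed

end
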